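(* Let $\Gamma=\{r,b\}$ and let $R^{rb}\subset R^r,R^b\subset R$ be a compatible Frobenius square which satisfies condition $\star$ and has no $\mu$-zero divisors. Then $$\partial_r\bigl(\Delta^b_{rb(1)}\bigr)\,\Delta^b_{rb(2)}=\frac{\mu_{rb}}{\mu_r\,\mu_b},$$ where the left-hand side is an element of $R$ and the equality takes place in the localization $R[\mu_{rb}^{-1}]\supset R$ (in which $\mu_r$ and $\mu_b$ are invertible).
   Context: All rings are commutative algebras over a field $\Bbbk$. A Frobenius extension is an extension $A\subset B$ with $B$ free and finitely generated as an $A$-module, together with an $A$-linear trace $\partial^B_A\colon B\to A$ for which there exist $A$-bases $\{x_\alpha\},\{y_\alpha\}$ of $B$ with $\partial^B_A(x_\alpha y_\beta)=\delta_{\alpha\beta}$ (dual bases). A compatible Frobenius square with $\Gamma=\{r,b\}$ consists of rings $R=R^\emptyset\supset R^r,R^b\supset R^{rb}$ with traces $\partial_r\colon R\to R^r$, $\partial_b\colon R\to R^b$, $\partial^r_{rb}\colon R^r\to R^{rb}$, $\partial^b_{rb}\colon R^b\to R^{rb}$ making each of the four inclusions a Frobenius extension, and with $\partial^r_{rb}\partial_r=\partial^b_{rb}\partial_b=:\partial_{rb}$. Then $R^{rb}\subset R$ is a Frobenius extension with trace $\partial_{rb}$. Sweedler notation: for $I\subset J\subset\Gamma$, an expression containing $\Delta^I_{J(1)}$ and $\Delta^I_{J(2)}$ means the sum over $\alpha$ of the expression with $x_\alpha$ in place of $\Delta^I_{J(1)}$ and $y_\alpha$ in place of $\Delta^I_{J(2)}$,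 where $\{x_\alpha\},\{y_\alpha\}$ are dual bases of $R^I$ over $R^J$; it is independent of the choice. Set $\mu^I_J=\Delta^I_{J(1)}\Delta^I_{J(2)}\in R^I$ and $\mu_J=\mu^\emptyset_J\in R$. One has $\mu_{rb}=\mu^r_{rb}\mu_r=\mu^b_{rb}\mu_b$. Condition $\star$: there are dual bases $\{x_\alpha\},\{y_\alpha\}$ of $R$ over $R^b$ such that $x_\alpha\in R^r$ for all $\alpha$. No $\mu$-zero divisors: $\mu_{rb}=\mu_\Gamma\in R$ is not a zero divisor (in particular it is nonzero). *)

theory Defs
  imports "HOL-Algebra.Algebra"
begin

text \<open>The rings in an extension are subrings of one commutative ring \<open>R\<close> and are represented by their
  carriers. A finite basis is an indexed family \<open>x 0, \<dots>, x (n - 1)\<close>.\<close>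

definition is_basis :: "('a, 'm) ring_scheme \<Rightarrow> 'a set \<Rightarrow> 'a set \<Rightarrow> nat \<Rightarrow> (nat \<Rightarrow> 'a) \<Rightarrow> bool" where
  "is_basis R A B n x \<longleftrightarrow>
     x \<in> {..<n} \<rightarrow> B \<and>
     (\<forall>u\<in>B. \<exists>c\<in>{..<n} \<rightarrow> A. u = (\<Oplus>\<^bsub>R\<^esub>i\<in>{..<n}. c i \<otimes>\<^bsub>R\<^esub> x i)) \<and>
     (\<forall>c\<in>{..<n} \<rightarrow> A. (\<Oplus>\<^bsub>R\<^esub>i\<in>{..<n}. c i \<otimes>\<^bsub>R\<^esub> x i) = \<zero>\<^bsub>R\<^esub> \<longrightarrow> (\<forall>i<n. c i = \<zero>\<^bsub>R\<^esub>))"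

definition dual_bases ::
  "('a, 'm) ring_scheme \<Rightarrow> 'a set \<Rightarrow> 'a set \<Rightarrow> ('a \<Rightarrow> 'a) \<Rightarrow> nat \<Rightarrow> (nat \<Rightarrow> 'a) \<Rightarrow> (nat \<Rightarrow> 'a) \<Rightarrow> bool" where
  "dual_bases R A B tr n x y \<longleftrightarrow>
     is_basis R A B n x \<and> is_basis R A B n y \<and>
     (\<forall>i<n. \<forall>j<n. tr (x i \<otimes>\<^bsub>R\<^esub> y j) = (if i = j then \<one>\<^bsub>R\<^esub> else \<zero>\<^bsub>R\<^esub>))"

definition is_linear :: "('a, 'm) ring_scheme \<Rightarrow> 'a set \<Rightarrow> 'a set \<Rightarrow> ('a \<Rightarrow> 'a) \<Rightarrow> bool" where
  "is_linear R A B tr \<longleftrightarrow>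
     (\<forall>u\<in>B. \<forall>v\<in>B. tr (u \<oplus>\<^bsub>R\<^esub> v) = tr u \<oplus>\<^bsub>R\<^esub> tr v) \<and>
     (\<forall>a\<in>A. \<forall>u\<in>B. tr (a \<otimes>\<^bsub>R\<^esub> u) = a \<otimes>\<^bsub>R\<^esub> tr u)"

definition frobenius_extension ::
  "('a, 'm) ring_scheme \<Rightarrow> 'a set \<Rightarrow> 'a set \<Rightarrow> ('a \<Rightarrow> 'a) \<Rightarrow> bool" where
  "frobenius_extension R A B tr \<longleftrightarrow>
     subcring A R \<and> subcring B R \<and> A \<subseteq> B \<and>
     tr \<in> B \<rightarrow> A \<and> is_linear R A B tr \<and>
     (\<exists>n x y. dual_bases R A B tr n x y)"

text \<open>\<open>sweedler R A B tr f\<close> is the value of the expression \<open>f \<Delta>\<^sub>(\<^sub>1\<^sub>) \<Delta>\<^sub>(\<^sub>2\<^sub>)\<close> for the extension \<open>A \<subseteq> B\<close>. The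
  choice of dual bases is immaterial when \<open>f\<close> is biadditive and \<open>A\<close>-balanced, see \<open>sweedler_eq\<close>.\<close>

definition sweedler ::
  "('a, 'm) ring_scheme \<Rightarrow> 'a set \<Rightarrow> 'a set \<Rightarrow> ('a \<Rightarrow> 'a) \<Rightarrow> ('a \<Rightarrow> 'a \<Rightarrow> 'a) \<Rightarrow> 'a" where
  "sweedler R A B tr f =
     (case (SOME (n, x, y). dual_bases R A B tr n x y) of
        (n, x, y) \<Rightarrow> \<Oplus>\<^bsub>R\<^esub>i\<in>{..<n}. f (x i) (y i))"

definition frob_mu :: "('a, 'm) ring_scheme \<Rightarrow> 'a set \<Rightarrow> 'a set \<Rightarrow> ('a \<Rightarrow> 'a) \<Rightarrow> 'a" where
  "frob_mu R A B tr = sweedler R A B tr (\<lambda>u v. u \<otimes>\<^bsub>R\<^esub> v)"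

context cring
begin

lemma finsum_swap:
  assumes "finite I" "finite J" "\<And>i j. i \<in> I \<Longrightarrow> j \<in> J \<Longrightarrow> g i j \<in> carrier R"
  shows "(\<Oplus>i\<in>I. \<Oplus>j\<in>J. g i j) = (\<Oplus>j\<in>J. \<Oplus>i\<in>I. g i j)"
  using assms(1,3)
proof (induction I rule: finite_induct)
  case empty
  then show ?case by simp
next
  case (insert a I)
  have "(\<Oplus>j\<in>J. \<Oplus>i\<in>insert a I. g i j) = (\<Oplus>j\<in>J. g a j \<oplus> (\<Oplus>i\<in>I. g i j))"
    using insert by (intro finsum_cong') (auto simp: Pi_iff)
  also have "\<dots> = (\<Oplus>j\<in>J. g a j) \<oplus> (\<Oplus>j\<in>J. \<Oplus>i\<in>I. g i j)"
    using insert by (intro finsum_addf) auto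
  finally show ?case
    using insert by (simp add: Pi_iff)
qed

lemma additive_finsum:
  assumes "subring B R" "\<And>u v. u \<in> B \<Longrightarrow> v \<in> B \<Longrightarrow> h (u \<oplus> v) = h u \<oplus> h v"
    "\<And>u. u \<in> B \<Longrightarrow> h u \<in> carrier R" "finite I" "g \<in> I \<rightarrow> B"
  shows "(\<Oplus>i\<in>I. g i) \<in> B \<and> h (\<Oplus>i\<in>I. g i) = (\<Oplus>i\<in>I. h (g i))"
  using assms(4,5)
proof (induction I rule: finite_induct)
  case empty
  have z: "\<zero> \<in> B" using assms(1) by (rule subringE)
  have "h \<zero> = h \<zero> \<oplus> h \<zero>" using assms(2)[OF z z] by simp
  then have "h \<zero> = \<zero>" using assms(3)[OF z] by (metis add.r_cancel_one')
  then show ?case using z by simp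
next
  case (insert a I)
  have sub: "B \<subseteq> carrier R" using assms(1) by (rule subringE)
  have ga: "g a \<in> B" "g \<in> I \<rightarrow> B" "g \<in> I \<rightarrow> carrier R" "(\<lambda>i. h (g i)) \<in> I \<rightarrow> carrier R"
    using insert.prems sub assms(3) by auto
  show ?case
    using insert.IH[OF ga(2)] insert.hyps ga sub assms(2,3) subringE(7)[OF assms(1)]
    by auto
qed

lemma dual_bases_expand:
  assumes F: "frobenius_extension R A B tr" and D: "dual_bases R A B tr n x y" and u: "u \<in> B"
  shows "u = (\<Oplus>i\<in>{..<n}. tr (u \<otimes> y i) \<otimes> x i)" "u = (\<Oplus>i\<in>{..<n}. tr (x i \<otimes> u) \<otimes> y i)"
proof -
  have A: "subring A R" and B: "subring B R" and AB: "A \<subseteq> B" and t: "tr \<in> B \<rightarrow> A"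
    and ta: "\<And>u v. u \<in> B \<Longrightarrow> v \<in> B \<Longrightarrow> tr (u \<oplus> v) = tr u \<oplus> tr v"
    and tl: "\<And>a u. a \<in> A \<Longrightarrow> u \<in> B \<Longrightarrow> tr (a \<otimes> u) = a \<otimes> tr u"
    using F by (auto simp: frobenius_extension_def is_linear_def subcring_def)
  have BR: "B \<subseteq> carrier R" using B by (rule subringE)
  have xy: "\<And>i. i < n \<Longrightarrow> x i \<in> B" "\<And>i. i < n \<Longrightarrow> y i \<in> B"
    and d: "\<And>i j. i < n \<Longrightarrow> j < n \<Longrightarrow> tr (x i \<otimes> y j) = (if i = j then \<one> else \<zero>)"
    using D by (auto simp: dual_bases_def is_basis_def)
  note cl = subringE(6)[OF B]
  have main: "c j = tr ((\<Oplus>i\<in>{..<n}. c i \<otimes> z i) \<otimes> w)"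
    if c: "c \<in> {..<n} \<rightarrow> A" and z: "\<And>i. i < n \<Longrightarrow> z i \<in> B" and w: "w \<in> B" and j: "j < n"
      and e: "\<And>i. i < n \<Longrightarrow> tr (z i \<otimes> w) = (if i = j then \<one> else \<zero>)" for c z w j
  proof -
    have cA: "\<And>i. i < n \<Longrightarrow> c i \<in> A" "\<And>i. i < n \<Longrightarrow> c i \<in> B" "\<And>i. i < n \<Longrightarrow> c i \<in> carrier R"
      "\<And>i. i < n \<Longrightarrow> z i \<in> carrier R" "w \<in> carrier R"
      using c z w AB BR by auto
    have "(\<Oplus>i\<in>{..<n}. c i \<otimes> z i) \<otimes> w = (\<Oplus>i\<in>{..<n}. c i \<otimes> z i \<otimes> w)"
      using cA by (intro finsum_ldistr) auto
    also have "\<dots> = (\<Oplus>i\<in>{..<n}. c i \<otimes> (z i \<otimes> w))"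
      using cA by (intro finsum_cong') (auto simp: m_assoc)
    also have "tr \<dots> = (\<Oplus>i\<in>{..<n}. tr (c i \<otimes> (z i \<otimes> w)))"
      using additive_finsum[OF B ta, of "{..<n}" "\<lambda>i. c i \<otimes> (z i \<otimes> w)"] t AB BR cA z w cl
      by (auto simp: Pi_iff)
    also have "\<dots> = (\<Oplus>i\<in>{..<n}. if j = i then c i else \<zero>)"
      using cA z w cl by (intro finsum_cong') (auto simp: tl e)
    also have "\<dots> = c j"
      using cA j by (intro finsum_singleton) auto
    finally show ?thesis by simp
  qed
  obtain c where c: "c \<in> {..<n} \<rightarrow> A" "u = (\<Oplus>i\<in>{..<n}. c i \<otimes> x i)"
    using D u by (auto simp: dual_bases_def is_basis_def)
  have "c j = tr (u \<otimes> y j)" if "j < n" for j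
    using main[OF c(1) xy(1) xy(2)[OF that] that] d that c(2) by simp
  then have "(\<Oplus>i\<in>{..<n}. c i \<otimes> x i) = (\<Oplus>i\<in>{..<n}. tr (u \<otimes> y i) \<otimes> x i)"
    using t AB BR u xy cl by (intro finsum_cong') (auto simp: Pi_iff subset_iff)
  then show "u = (\<Oplus>i\<in>{..<n}. tr (u \<otimes> y i) \<otimes> x i)" using c(2) by simp
  obtain e where e: "e \<in> {..<n} \<rightarrow> A" "u = (\<Oplus>i\<in>{..<n}. e i \<otimes> y i)"
    using D u by (auto simp: dual_bases_def is_basis_def)
  have "e j = tr (x j \<otimes> u)" if j: "j < n" for j
  proof -
    have "tr (y i \<otimes> x j) = (if i = j then \<one> else \<zero>)" if "i < n" for i
      using d[OF j that] xy that j BR by (auto simp: m_comm subset_iff)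
    then have "e j = tr (u \<otimes> x j)"
      using main[OF e(1) xy(2) xy(1)[OF j] j] e(2) by simp
    then show ?thesis using xy(1)[OF j] u BR by (auto simp: m_comm subset_iff)
  qed
  then have "(\<Oplus>i\<in>{..<n}. e i \<otimes> y i) = (\<Oplus>i\<in>{..<n}. tr (x i \<otimes> u) \<otimes> y i)"
    using t AB BR u xy cl by (intro finsum_cong') (auto simp: Pi_iff subset_iff)
  then show "u = (\<Oplus>i\<in>{..<n}. tr (x i \<otimes> u) \<otimes> y i)" using e(2) by simp
qed

lemma sweedler_independent:
  assumes F: "frobenius_extension R A B tr"
    and D: "dual_bases R A B tr n x y" and D': "dual_bases R A B tr n' x' y'"
    and fc: "\<And>u v. u \<in> B \<Longrightarrow> v \<in> B \<Longrightarrow> f u v \<in> carrier R"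
    and fl: "\<And>u u' v. u \<in> B \<Longrightarrow> u' \<in> B \<Longrightarrow> v \<in> B \<Longrightarrow> f (u \<oplus> u') v = f u v \<oplus> f u' v"
    and fr: "\<And>u v v'. u \<in> B \<Longrightarrow> v \<in> B \<Longrightarrow> v' \<in> B \<Longrightarrow> f u (v \<oplus> v') = f u v \<oplus> f u v'"
    and fb: "\<And>a u v. a \<in> A \<Longrightarrow> u \<in> B \<Longrightarrow> v \<in> B \<Longrightarrow> f (a \<otimes> u) v = f u (a \<otimes> v)"
  shows "(\<Oplus>i\<in>{..<n}. f (x i) (y i)) = (\<Oplus>j\<in>{..<n'}. f (x' j) (y' j))"
proof -
  have B: "subring B R" and AB: "A \<subseteq> B" and t: "tr \<in> B \<rightarrow> A"
    using F by (auto simp: frobenius_extension_def subcring_def)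
  have xy: "\<And>i. i < n \<Longrightarrow> x i \<in> B" "\<And>i. i < n \<Longrightarrow> y i \<in> B"
    "\<And>i. i < n' \<Longrightarrow> x' i \<in> B" "\<And>i. i < n' \<Longrightarrow> y' i \<in> B"
    using D D' by (auto simp: dual_bases_def is_basis_def)
  note cl = subringE(6)[OF B]
  define c where "c i j = tr (x i \<otimes> y' j)" for i j
  have cA: "c i j \<in> A" "c i j \<in> B" if "i < n" "j < n'" for i j
    using t AB cl xy that by (auto simp: c_def Pi_iff)
  have 1: "f (x i) (y i) = (\<Oplus>j\<in>{..<n'}. f (c i j \<otimes> x' j) (y i))" if i: "i < n" for i
  proof -
    have "x i = (\<Oplus>j\<in>{..<n'}. c i j \<otimes> x' j)"
      unfolding c_def by (rule dual_bases_expand(1)[OF F D' xy(1)[OF i]])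
    then show ?thesis
      using additive_finsum[OF B, of "\<lambda>u. f u (y i)" "{..<n'}" "\<lambda>j. c i j \<otimes> x' j"]
        fl fc xy i cA cl by (auto simp: Pi_iff)
  qed
  have 2: "f (x' j) (y' j) = (\<Oplus>i\<in>{..<n}. f (x' j) (c i j \<otimes> y i))" if j: "j < n'" for j
  proof -
    have "y' j = (\<Oplus>i\<in>{..<n}. c i j \<otimes> y i)"
      unfolding c_def by (rule dual_bases_expand(2)[OF F D xy(4)[OF j]])
    then show ?thesis
      using additive_finsum[OF B, of "\<lambda>v. f (x' j) v" "{..<n}" "\<lambda>i. c i j \<otimes> y i"]
        fr fc xy j cA cl by (auto simp: Pi_iff)
  qed
  have "(\<Oplus>i\<in>{..<n}. f (x i) (y i)) = (\<Oplus>i\<in>{..<n}. \<Oplus>j\<in>{..<n'}. f (x' j) (c i j \<otimes> y i))"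
  proof (intro finsum_cong')
    fix i assume "i \<in> {..<n}"
    then have i: "i < n" by simp
    have "(\<Oplus>j\<in>{..<n'}. f (c i j \<otimes> x' j) (y i)) = (\<Oplus>j\<in>{..<n'}. f (x' j) (c i j \<otimes> y i))"
      using i xy cA cl fc by (intro finsum_cong') (auto simp: fb)
    then show "f (x i) (y i) = (\<Oplus>j\<in>{..<n'}. f (x' j) (c i j \<otimes> y i))"
      using 1[OF i] by simp
  qed (use xy cA cl fc in auto)
  also have "\<dots> = (\<Oplus>j\<in>{..<n'}. \<Oplus>i\<in>{..<n}. f (x' j) (c i j \<otimes> y i))"
    using xy cA cl fc by (intro finsum_swap) auto
  also have "\<dots> = (\<Oplus>j\<in>{..<n'}. f (x' j) (y' j))"
    using 2[symmetric] xy fc by (intro finsum_cong') auto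
  finally show ?thesis .
qed

lemma sweedler_eq:
  assumes "frobenius_extension R A B tr" "dual_bases R A B tr n x y"
    and "\<And>u v. u \<in> B \<Longrightarrow> v \<in> B \<Longrightarrow> f u v \<in> carrier R"
    and "\<And>u u' v. u \<in> B \<Longrightarrow> u' \<in> B \<Longrightarrow> v \<in> B \<Longrightarrow> f (u \<oplus> u') v = f u v \<oplus> f u' v"
    and "\<And>u v v'. u \<in> B \<Longrightarrow> v \<in> B \<Longrightarrow> v' \<in> B \<Longrightarrow> f u (v \<oplus> v') = f u v \<oplus> f u v'"
    and "\<And>a u v. a \<in> A \<Longrightarrow> u \<in> B \<Longrightarrow> v \<in> B \<Longrightarrow> f (a \<otimes> u) v = f u (a \<otimes> v)"
  shows "sweedler R A B tr f = (\<Oplus>i\<in>{..<n}. f (x i) (y i))"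
proof -
  obtain n' x' y' where e: "(SOME (n, x, y). dual_bases R A B tr n x y) = (n', x', y')"
    by (metis prod_cases3)
  have "case (SOME (n, x, y). dual_bases R A B tr n x y) of (n, x, y) \<Rightarrow> dual_bases R A B tr n x y"
    by (rule someI[of _ "(n, x, y)"]) (simp add: assms(2))
  then have "dual_bases R A B tr n' x' y'" unfolding e by simp
  then show ?thesis
    unfolding sweedler_def e using sweedler_independent[OF assms(1) _ assms(2-6)] by simp
qed

end

text \<open>\<open>R\<close> is the ambient \<open>K\<close>-algebra, with subalgebras \<open>Rr\<close>, \<open>Rb\<close>, \<open>Rrb\<close>. The maps \<open>tr_r_rb\<close> and \<open>tr_b_rb\<close> are
  the traces from \<open>Rr\<close>, respectively \<open>Rb\<close>, to \<open>Rrb\<close>.\<close>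

definition compatible_frobenius_square ::
  "('k, 'l) ring_scheme \<Rightarrow> ('k, 'a, 'm) module_scheme \<Rightarrow> 'a set \<Rightarrow> 'a set \<Rightarrow> 'a set \<Rightarrow>
   ('a \<Rightarrow> 'a) \<Rightarrow> ('a \<Rightarrow> 'a) \<Rightarrow> ('a \<Rightarrow> 'a) \<Rightarrow> ('a \<Rightarrow> 'a) \<Rightarrow> bool" where
  "compatible_frobenius_square K R Rr Rb Rrb tr_r tr_b tr_r_rb tr_b_rb \<longleftrightarrow>
     field K \<and> algebra K R \<and>
     submodule Rr K R \<and> submodule Rb K R \<and> submodule Rrb K R \<and>
     frobenius_extension R Rr (carrier R) tr_r \<and>
     frobenius_extension R Rb (carrier R) tr_b \<and>
     frobenius_extension R Rrb Rr tr_r_rb \<and>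
     frobenius_extension R Rrb Rb tr_b_rb \<and>
     (\<forall>u\<in>carrier R. tr_r_rb (tr_r u) = tr_b_rb (tr_b u))"

definition condition_star ::
  "('a, 'm) ring_scheme \<Rightarrow> 'a set \<Rightarrow> 'a set \<Rightarrow> ('a \<Rightarrow> 'a) \<Rightarrow> bool" where
  "condition_star R Rr Rb tr_b \<longleftrightarrow>
     (\<exists>n x y. dual_bases R Rb (carrier R) tr_b n x y \<and> (\<forall>i<n. x i \<in> Rr))"

definition non_zero_divisor :: "('a, 'm) ring_scheme \<Rightarrow> 'a \<Rightarrow> bool" where
  "non_zero_divisor R s \<longleftrightarrow>
     s \<in> carrier R \<and> s \<noteq> \<zero>\<^bsub>R\<^esub> \<and> (\<forall>u\<in>carrier R. s \<otimes>\<^bsub>R\<^esub> u = \<zero>\<^bsub>R\<^esub> \<longrightarrow> u = \<zero>\<^bsub>R\<^esub>)"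

text \<open>\<open>loc_frac R s a m\<close> is the fraction \<open>a / s ^ m\<close>.\<close>

definition loc_frac :: "('a, 'm) ring_scheme \<Rightarrow> 'a \<Rightarrow> 'a \<Rightarrow> nat \<Rightarrow> ('a \<times> nat) set" where
  "loc_frac R s a m =
     {(b, n). b \<in> carrier R \<and>
        (\<exists>k::nat. s [^]\<^bsub>R\<^esub> k \<otimes>\<^bsub>R\<^esub> (a \<otimes>\<^bsub>R\<^esub> s [^]\<^bsub>R\<^esub> n) = s [^]\<^bsub>R\<^esub> k \<otimes>\<^bsub>R\<^esub> (b \<otimes>\<^bsub>R\<^esub> s [^]\<^bsub>R\<^esub> m))}"

definition localization :: "('a, 'm) ring_scheme \<Rightarrow> 'a \<Rightarrow> ('a \<times> nat) set ring" where
  "localization R s =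
    \<lparr> carrier = {loc_frac R s a m | a m. a \<in> carrier R},
      monoid.mult = (\<lambda>P Q. \<Union>(a, m)\<in>P. \<Union>(b, n)\<in>Q. loc_frac R s (a \<otimes>\<^bsub>R\<^esub> b) (m + n)),
      monoid.one = loc_frac R s \<one>\<^bsub>R\<^esub> 0,
      ring.zero = loc_frac R s \<zero>\<^bsub>R\<^esub> 0,
      ring.add = (\<lambda>P Q. \<Union>(a, m)\<in>P. \<Union>(b, n)\<in>Q.
               loc_frac R s (a \<otimes>\<^bsub>R\<^esub> s [^]\<^bsub>R\<^esub> n \<oplus>\<^bsub>R\<^esub> b \<otimes>\<^bsub>R\<^esub> s [^]\<^bsub>R\<^esub> m) (m + n)) \<rparr>"

definition loc_of :: "('a, 'm) ring_scheme \<Rightarrow> 'a \<Rightarrow> 'a \<Rightarrow> ('a \<times> nat) set" where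
  "loc_of R s a = loc_frac R s a 0"

context cring
begin

lemma loc_frac_sym:
  assumes "(b, n) \<in> loc_frac R s a m" "a \<in> carrier R"
  shows "(a, m) \<in> loc_frac R s b n"
  using assms by (auto simp: loc_frac_def) metis

lemma loc_frac_trans:
  assumes s: "s \<in> carrier R" and a: "a \<in> carrier R"
    and 1: "(b, n) \<in> loc_frac R s a m" and 2: "(c, p) \<in> loc_frac R s b n"
  shows "(c, p) \<in> loc_frac R s a m"
proof -
  obtain k :: nat where k: "s [^] k \<otimes> (a \<otimes> s [^] n) = s [^] k \<otimes> (b \<otimes> s [^] m)" and b: "b \<in> carrier R"
    using 1 unfolding loc_frac_def by blast
  obtain l :: nat where l: "s [^] l \<otimes> (b \<otimes> s [^] p) = s [^] l \<otimes> (c \<otimes> s [^] n)" and c: "c \<in> carrier R"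
    using 2 unfolding loc_frac_def by blast
  have "s [^] (k + l + n) \<otimes> (a \<otimes> s [^] p) = (s [^] k \<otimes> (a \<otimes> s [^] n)) \<otimes> (s [^] l \<otimes> s [^] p)"
    using s a by (simp add: nat_pow_mult[symmetric] m_ac)
  also have "\<dots> = (s [^] l \<otimes> (b \<otimes> s [^] p)) \<otimes> (s [^] k \<otimes> s [^] m)"
    using s b k by (simp add: m_ac)
  also have "\<dots> = s [^] (k + l + n) \<otimes> (c \<otimes> s [^] m)"
    using s c by (simp only: l) (simp add: nat_pow_mult[symmetric] m_ac)
  finally show ?thesis using c by (auto simp: loc_frac_def)
qed

lemma loc_frac_refl: "a \<in> carrier R \<Longrightarrow> (a, m) \<in> loc_frac R s a m"
  by (auto simp: loc_frac_def)

lemma loc_frac_eq: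
  assumes "s \<in> carrier R" "a \<in> carrier R" "(b, n) \<in> loc_frac R s a m"
  shows "loc_frac R s b n = loc_frac R s a m"
proof -
  have b: "b \<in> carrier R" using assms(3) by (simp add: loc_frac_def)
  show ?thesis
    using loc_frac_trans[OF assms(1,2,3)]
      loc_frac_trans[OF assms(1) b loc_frac_sym[OF assms(3,2)]] by auto
qed

lemma loc_frac_eq_iff:
  assumes "s \<in> carrier R" "a \<in> carrier R" "b \<in> carrier R"
  shows "loc_frac R s a m = loc_frac R s b n \<longleftrightarrow>
    (\<exists>k::nat. s [^] k \<otimes> (a \<otimes> s [^] n) = s [^] k \<otimes> (b \<otimes> s [^] m))"
proof -
  have "loc_frac R s a m = loc_frac R s b n \<longleftrightarrow> (b, n) \<in> loc_frac R s a m"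
    using loc_frac_eq[OF assms(1,2)] loc_frac_refl[OF assms(3)] by auto
  then show ?thesis using assms by (auto simp: loc_frac_def)
qed

lemma UN_loc_frac:
  assumes a: "a \<in> carrier R" and b: "b \<in> carrier R"
    and g: "\<And>a' m' b' n'. (a', m') \<in> loc_frac R s a m \<Longrightarrow> (b', n') \<in> loc_frac R s b n \<Longrightarrow>
      g a' m' b' n' = g a m b n"
  shows "(\<Union>(a, m)\<in>loc_frac R s a m. \<Union>(b, n)\<in>loc_frac R s b n. g a m b n) = g a m b n"
proof -
  have "(\<Union>(a, m)\<in>loc_frac R s a m. \<Union>(b, n)\<in>loc_frac R s b n. g a m b n) =
    (\<Union>p\<in>loc_frac R s a m. \<Union>q\<in>loc_frac R s b n. g a m b n)"
    using g by (intro SUP_cong) (auto split: prod.splits)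
  also have "\<dots> = g a m b n"
    using loc_frac_refl[OF a] loc_frac_refl[OF b] by blast
  finally show ?thesis .
qed

lemma loc_mult:
  assumes s: "s \<in> carrier R" and a: "a \<in> carrier R" and b: "b \<in> carrier R"
  shows "loc_frac R s a m \<otimes>\<^bsub>localization R s\<^esub> loc_frac R s b n = loc_frac R s (a \<otimes> b) (m + n)"
proof -
  have "loc_frac R s (a' \<otimes> b') (m' + n') = loc_frac R s (a \<otimes> b) (m + n)"
    if h: "(a', m') \<in> loc_frac R s a m" "(b', n') \<in> loc_frac R s b n" for a' m' b' n'
  proof -
    obtain k :: nat where k: "s [^] k \<otimes> (a \<otimes> s [^] m') = s [^] k \<otimes> (a' \<otimes> s [^] m)" and a': "a' \<in> carrier R"
      using h unfolding loc_frac_def by blast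
    obtain l :: nat where l: "s [^] l \<otimes> (b \<otimes> s [^] n') = s [^] l \<otimes> (b' \<otimes> s [^] n)" and b': "b' \<in> carrier R"
      using h unfolding loc_frac_def by blast
    have "s [^] (k + l) \<otimes> ((a' \<otimes> b') \<otimes> s [^] (m + n)) =
      (s [^] k \<otimes> (a' \<otimes> s [^] m)) \<otimes> (s [^] l \<otimes> (b' \<otimes> s [^] n))"
      using s a' b' by (simp add: nat_pow_mult[symmetric] m_ac)
    also have "\<dots> = s [^] (k + l) \<otimes> ((a \<otimes> b) \<otimes> s [^] (m' + n'))"
      using s a b by (simp only: k[symmetric] l[symmetric]) (simp add: nat_pow_mult[symmetric] m_ac)
    finally show ?thesis using s a b a' b' by (subst loc_frac_eq_iff) auto
  qed
  then have "(\<Union>(a, m)\<in>loc_frac R s a m. \<Union>(b, n)\<in>loc_frac R s b n. loc_frac R s (a \<otimes> b) (m + n)) =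
    loc_frac R s (a \<otimes> b) (m + n)"
    by (rule UN_loc_frac[OF a b])
  then show ?thesis by (simp add: localization_def)
qed

lemma loc_add:
  assumes s: "s \<in> carrier R" and a: "a \<in> carrier R" and b: "b \<in> carrier R"
  shows "loc_frac R s a m \<oplus>\<^bsub>localization R s\<^esub> loc_frac R s b n =
    loc_frac R s (a \<otimes> s [^] n \<oplus> b \<otimes> s [^] m) (m + n)"
proof -
  have "loc_frac R s (a' \<otimes> s [^] n' \<oplus> b' \<otimes> s [^] m') (m' + n') =
      loc_frac R s (a \<otimes> s [^] n \<oplus> b \<otimes> s [^] m) (m + n)"
    if h: "(a', m') \<in> loc_frac R s a m" "(b', n') \<in> loc_frac R s b n" for a' m' b' n'
  proof -
    obtain k :: nat where k: "s [^] k \<otimes> (a \<otimes> s [^] m') = s [^] k \<otimes> (a' \<otimes> s [^] m)" and a': "a' \<in> carrier R"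
      using h unfolding loc_frac_def by blast
    obtain l :: nat where l: "s [^] l \<otimes> (b \<otimes> s [^] n') = s [^] l \<otimes> (b' \<otimes> s [^] n)" and b': "b' \<in> carrier R"
      using h unfolding loc_frac_def by blast
    have "s [^] (k + l) \<otimes> ((a' \<otimes> s [^] n' \<oplus> b' \<otimes> s [^] m') \<otimes> s [^] (m + n)) =
      (s [^] k \<otimes> (a' \<otimes> s [^] m)) \<otimes> (s [^] l \<otimes> s [^] n' \<otimes> s [^] n) \<oplus>
      (s [^] l \<otimes> (b' \<otimes> s [^] n)) \<otimes> (s [^] k \<otimes> s [^] m' \<otimes> s [^] m)"
      using s a' b' by (simp add: nat_pow_mult[symmetric] m_ac l_distr r_distr)
    also have "\<dots> = s [^] (k + l) \<otimes> ((a \<otimes> s [^] n \<oplus> b \<otimes> s [^] m) \<otimes> s [^] (m' + n'))"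
      using s a b by (simp only: k[symmetric] l[symmetric])
        (simp add: nat_pow_mult[symmetric] m_ac l_distr r_distr)
    finally show ?thesis using s a b a' b' by (subst loc_frac_eq_iff) auto
  qed
  then have "(\<Union>(a, m)\<in>loc_frac R s a m. \<Union>(b, n)\<in>loc_frac R s b n.
      loc_frac R s (a \<otimes> s [^] n \<oplus> b \<otimes> s [^] m) (m + n)) =
    loc_frac R s (a \<otimes> s [^] n \<oplus> b \<otimes> s [^] m) (m + n)"
    by (rule UN_loc_frac[OF a b])
  then show ?thesis by (simp add: localization_def)
qed

lemma loc_carrier: "P \<in> carrier (localization R s) \<longleftrightarrow> (\<exists>a m. a \<in> carrier R \<and> P = loc_frac R s a m)"
  by (auto simp: localization_def)

lemma loc_carrierE:
  assumes "P \<in> carrier (localization R s)"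
  obtains a m where "a \<in> carrier R" "P = loc_frac R s a m"
  using assms by (auto simp: loc_carrier)

lemma loc_frac_closed: "a \<in> carrier R \<Longrightarrow> loc_frac R s a m \<in> carrier (localization R s)"
  by (auto simp: loc_carrier)

lemma loc_one: "\<one>\<^bsub>localization R s\<^esub> = loc_frac R s \<one> 0"
  and loc_zero: "\<zero>\<^bsub>localization R s\<^esub> = loc_frac R s \<zero> 0"
  by (simp_all add: localization_def)

lemma loc_frac_eqI:
  assumes "s \<in> carrier R" "a \<in> carrier R" "b \<in> carrier R" "a \<otimes> s [^] n = b \<otimes> s [^] m"
  shows "loc_frac R s a m = loc_frac R s b n"
  using assms by (subst loc_frac_eq_iff) auto

lemma localization_cring:
  assumes s: "s \<in> carrier R"
  shows "cring (localization R s)"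
proof (intro cringI abelian_groupI comm_monoidI)
  fix P assume "P \<in> carrier (localization R s)"
  then obtain a m where a: "a \<in> carrier R" and P: "P = loc_frac R s a m"
    by (auto simp: loc_carrier)
  have "loc_frac R s (\<ominus> a) m \<oplus>\<^bsub>localization R s\<^esub> P = \<zero>\<^bsub>localization R s\<^esub>"
    using s a loc_frac_eqI[of s \<zero> \<zero> 0 "m + m"]
    by (simp add: P loc_add loc_zero l_minus l_neg)
  then show "\<exists>W\<in>carrier (localization R s). W \<oplus>\<^bsub>localization R s\<^esub> P = \<zero>\<^bsub>localization R s\<^esub>"
    using a by (intro bexI[of _ "loc_frac R s (\<ominus> a) m"]) (auto simp: loc_carrier)
next
  fix P Q W
  assume "P \<in> carrier (localization R s)" "Q \<in> carrier (localization R s)"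
    "W \<in> carrier (localization R s)"
  then obtain a m b n c p where c: "a \<in> carrier R" "b \<in> carrier R" "c \<in> carrier R"
    and P: "P = loc_frac R s a m" "Q = loc_frac R s b n" "W = loc_frac R s c p"
    by (auto simp: loc_carrier)
  show "(P \<oplus>\<^bsub>localization R s\<^esub> Q) \<otimes>\<^bsub>localization R s\<^esub> W =
    P \<otimes>\<^bsub>localization R s\<^esub> W \<oplus>\<^bsub>localization R s\<^esub> Q \<otimes>\<^bsub>localization R s\<^esub> W"
    unfolding P using s c
    by (simp add: loc_mult loc_add)
      (intro loc_frac_eqI, simp_all add: nat_pow_mult[symmetric] m_ac l_distr r_distr)
qed (use s in \<open>auto elim!: loc_carrierE simp: loc_frac_closed loc_one loc_zero loc_mult loc_add
        nat_pow_mult[symmetric] m_ac a_ac l_distr r_distr add_ac\<close>)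

lemma loc_of_hom:
  assumes "s \<in> carrier R"
  shows "loc_of R s \<in> ring_hom R (localization R s)"
  using assms by (intro ring_hom_memI) (auto simp: loc_of_def loc_mult loc_add loc_one loc_frac_closed)

end

end

theory Submission
  imports Defs
begin

text \<open>If \<open>A \<subseteq> B \<subseteq> C\<close> is a tower of Frobenius extensions, products of dual bases are dual bases for
  \<open>A \<subseteq> C\<close>. Evaluate the Sweedler expression \<open>\<partial>\<^sub>r(\<Delta>\<^sub>(\<^sub>1\<^sub>)) \<Delta>\<^sub>(\<^sub>2\<^sub>)\<close> of \<open>R\<close> over \<open>R\<^sup>r\<^sup>b\<close> in two such
  bases. Through \<open>R\<^sup>r\<close> it is the \<open>\<mu>\<close> of \<open>R\<^sup>r\<close> over \<open>R\<^sup>r\<^sup>b\<close>, since expanding \<open>1\<close> in dual bases \<open>p\<close>, \<open>q\<close> of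
  \<open>R\<close> over \<open>R\<^sup>r\<close> gives \<open>\<Sum> \<partial>\<^sub>r(p\<^sub>i) q\<^sub>i = 1\<close>. Through \<open>R\<^sup>b\<close>, with the first basis taken in \<open>R\<^sup>r\<close> by \<open>\<star>\<close>, it is
  \<open>\<mu>\<^sub>b\<close> times the left-hand side. Multiplying by \<open>\<mu>\<^sub>r\<close> gives \<open>lhs \<mu>\<^sub>r \<mu>\<^sub>b = \<mu>\<^sub>r\<^sub>b\<close> already in \<open>R\<close>.\<close>

context cring
begin

section \<open>Finite double sums\<close>

text \<open>A basis is a family over \<open>{..<n}\<close>, so a product of two bases needs a single
  index: \<open>k < n * m\<close> stands for the pair \<open>(k div m, k mod m)\<close>. Each
  induction step splits off the last block of \<open>m\<close> indices, those with quotient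
  \<open>n\<close>.\<close>

lemma finsum_div_mod:
  fixes n m :: nat
  assumes "\<And>i j. i < n \<Longrightarrow> j < m \<Longrightarrow> h i j \<in> carrier R"
  shows "(\<Oplus>k\<in>{..<n * m}. h (k div m) (k mod m)) = (\<Oplus>i\<in>{..<n}. \<Oplus>j\<in>{..<m}. h i j)"
  using assms
proof (induction n)
  case 0
  then show ?case by simp
next
  case (Suc n)
  let ?g = "\<lambda>k. h (k div m) (k mod m)"
  have dm: "k div m < n \<and> k mod m < m" if "k < n * m" for k
    using that by (cases "m = 0") (auto simp: less_mult_imp_div_less)
  have split: "{..<Suc n * m} = {..<n * m} \<union> (\<lambda>j. n * m + j) ` {..<m}"
  proof (intro equalityI subsetI)
    fix k assume "k \<in> {..<Suc n * m}"
    then show "k \<in> {..<n * m} \<union> (\<lambda>j. n * m + j) ` {..<m}"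
      by (cases "k < n * m") (auto intro!: image_eqI[of _ _ "k - n * m"])
  qed auto
  have "(\<Oplus>k\<in>{..<Suc n * m}. ?g k) =
      (\<Oplus>k\<in>{..<n * m}. ?g k) \<oplus> (\<Oplus>k\<in>(\<lambda>j. n * m + j) ` {..<m}. ?g k)"
    unfolding split using Suc.prems dm by (intro finsum_Un_disjoint) (auto simp: less_SucI)
  also have "(\<Oplus>k\<in>(\<lambda>j. n * m + j) ` {..<m}. ?g k) = (\<Oplus>j\<in>{..<m}. ?g (n * m + j))"
    using Suc.prems by (intro finsum_reindex) (auto simp: inj_on_def)
  also have "\<dots> = (\<Oplus>j\<in>{..<m}. h n j)"
    using Suc.prems by (intro finsum_cong') auto
  also have "(\<Oplus>k\<in>{..<n * m}. ?g k) = (\<Oplus>i\<in>{..<n}. \<Oplus>j\<in>{..<m}. h i j)"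
    using Suc by simp
  finally show ?case
    using Suc.prems by (simp add: lessThan_Suc a_comm Pi_iff)
qed

lemma finsum_mult_finsum:
  assumes "finite I" "finite J" "\<And>i. i \<in> I \<Longrightarrow> a i \<in> carrier R" "\<And>j. j \<in> J \<Longrightarrow> b j \<in> carrier R"
  shows "(\<Oplus>i\<in>I. \<Oplus>j\<in>J. a i \<otimes> b j) = (\<Oplus>i\<in>I. a i) \<otimes> (\<Oplus>j\<in>J. b j)"
proof -
  have "(\<Oplus>i\<in>I. \<Oplus>j\<in>J. a i \<otimes> b j) = (\<Oplus>i\<in>I. a i \<otimes> (\<Oplus>j\<in>J. b j))"
    using assms by (intro finsum_cong') (auto simp: finsum_rdistr Pi_iff)
  also have "\<dots> = (\<Oplus>i\<in>I. a i) \<otimes> (\<Oplus>j\<in>J. b j)"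
    using assms by (intro finsum_ldistr[symmetric]) auto
  finally show ?thesis .
qed

section \<open>Basic properties of traces and dual bases\<close>

lemma frobenius_extensionD:
  assumes "frobenius_extension R A B tr"
  shows "subring A R" "subring B R" "A \<subseteq> B" "B \<subseteq> carrier R"
    "\<And>u. u \<in> B \<Longrightarrow> tr u \<in> A"
    "\<And>u v. u \<in> B \<Longrightarrow> v \<in> B \<Longrightarrow> tr (u \<oplus> v) = tr u \<oplus> tr v"
    "\<And>a u. a \<in> A \<Longrightarrow> u \<in> B \<Longrightarrow> tr (a \<otimes> u) = a \<otimes> tr u"
  using assms subringE(1)
  by (auto simp: frobenius_extension_def is_linear_def subcring_def Pi_iff)

lemma dual_basesD:
  assumes "dual_bases R A B tr n x y"
  shows "\<And>i. i < n \<Longrightarrow> x i \<in> B" "\<And>i. i < n \<Longrightarrow> y i \<in> B"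
    "\<And>i j. i < n \<Longrightarrow> j < n \<Longrightarrow> tr (x i \<otimes> y j) = (if i = j then \<one> else \<zero>)"
  using assms by (auto simp: dual_bases_def is_basis_def)

text \<open>The pairing given by the trace is symmetric because the ring is commutative. Facts
  proved for the first family of a dual pair thus carry over to the second.\<close>

lemma dual_bases_sym:
  assumes "dual_bases R A B tr n x y" "B \<subseteq> carrier R"
  shows "dual_bases R A B tr n y x"
proof -
  have "tr (y i \<otimes> x j) = (if i = j then \<one> else \<zero>)" if "i < n" "j < n" for i j
    using dual_basesD[OF assms(1)] assms(2) that by (auto simp: m_comm subset_iff)
  then show ?thesis using assms(1) by (simp add: dual_bases_def)
qed

lemma frobenius_extension_zero:
  assumes "frobenius_extension R A B tr"
  shows "tr \<zero> = \<zero>"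
proof -
  note F = frobenius_extensionD[OF assms]
  have "tr (\<zero> \<otimes> \<zero>) = \<zero> \<otimes> tr \<zero>"
    using F(7) subringE(2)[OF F(1)] subringE(2)[OF F(2)] by blast
  moreover have "tr \<zero> \<in> carrier R"
    using F(3-5) subringE(2)[OF F(2)] by blast
  ultimately show ?thesis by simp
qed

lemma frobenius_extension_finsum:
  assumes "frobenius_extension R A B tr" "finite I" "\<And>i. i \<in> I \<Longrightarrow> g i \<in> B"
  shows "tr (\<Oplus>i\<in>I. g i) = (\<Oplus>i\<in>I. tr (g i))"
proof -
  note F = frobenius_extensionD[OF assms(1)]
  have "tr u \<in> carrier R" if "u \<in> B" for u
    using F(3-5) that by blast
  then show ?thesis
    using additive_finsum[OF F(2) F(6), of I g] assms(2,3) by auto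
qed

section \<open>Towers of Frobenius extensions\<close>

text \<open>By \<open>B\<close>-linearity of \<open>s\<close>, the composite pairing of two products
  is \<open>t\<close> of \<open>u j \<otimes> v j'\<close> times the Kronecker delta
  \<open>s (x i \<otimes> y i')\<close>, so it becomes a product of two deltas. Spanning comes from
  expanding first over \<open>B\<close> and then over \<open>A\<close>; independence comes from
  pairing with the dual family.\<close>

lemma dual_bases_tower:
  assumes F1: "frobenius_extension R A B t" and F2: "frobenius_extension R B C s"
    and D1: "dual_bases R A B t m u v" and D2: "dual_bases R B C s n x y"
  shows "dual_bases R A C (t \<circ> s) (n * m)
    (\<lambda>k. x (k div m) \<otimes> u (k mod m)) (\<lambda>k. y (k div m) \<otimes> v (k mod m))"
proof -
  note f1 = frobenius_extensionD[OF F1] and f2 = frobenius_extensionD[OF F2]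
  note cB = subringE(6)[OF f1(2)] and cC = subringE(6)[OF f2(2)]
  have dm: "k div m < n" "k mod m < m" if "k < n * m" for k
    using that by (auto simp: less_mult_imp_div_less) (cases "m = 0"; simp)
  \<comment> \<open>The bases are quantified anew, here and in \<open>basis\<close>, so that both
    facts also apply after the two families of each dual pair are exchanged.\<close>
  have pairing: "t (s ((x i \<otimes> u j) \<otimes> (y i' \<otimes> v j'))) = (if i = i' \<and> j = j' then \<one> else \<zero>)"
    if D: "dual_bases R A B t m u v" "dual_bases R B C s n x y"
      and ij: "i < n" "i' < n" "j < m" "j' < m" for u v x y i i' j j'
  proof -
    note d1 = dual_basesD[OF D(1)] and d2 = dual_basesD[OF D(2)]
    have in_B: "u j \<in> B" "v j' \<in> B" "u j \<otimes> v j' \<in> B" and in_C: "x i \<in> C" "y i' \<in> C" "x i \<otimes> y i' \<in> C"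
      using d1 d2 ij cB cC by auto
    then have R: "u j \<in> carrier R" "v j' \<in> carrier R" "x i \<in> carrier R" "y i' \<in> carrier R"
      using f1(4) f2(4) by auto
    \<comment> \<open>The factors from \<open>B\<close> are collected in front, where they act as a
      scalar for \<open>s\<close>.\<close>
    have "(x i \<otimes> u j) \<otimes> (y i' \<otimes> v j') = (u j \<otimes> v j') \<otimes> (x i \<otimes> y i')"
      using R by (simp add: m_ac)
    then have "s ((x i \<otimes> u j) \<otimes> (y i' \<otimes> v j')) = (u j \<otimes> v j') \<otimes> (if i = i' then \<one> else \<zero>)"
      using f2(7)[OF in_B(3) in_C(3)] d2(3)[OF ij(1,2)] by simp
    then show ?thesis
      using R d1(3)[OF ij(3,4)] frobenius_extension_zero[OF F1] by auto
  qed
  have basis: "is_basis R A C (n * m) (\<lambda>k. x (k div m) \<otimes> u (k mod m))"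
    if D: "dual_bases R A B t m u v" "dual_bases R B C s n x y" for u v x y
  proof -
    note d1 = dual_basesD[OF D(1)] and d2 = dual_basesD[OF D(2)]
    let ?X = "\<lambda>k. x (k div m) \<otimes> u (k mod m)" and ?Y = "\<lambda>k. y (k div m) \<otimes> v (k mod m)"
    have XC: "?X k \<in> C" "?Y k \<in> C" if "k < n * m" for k
      using dm[OF that] d1(1,2) d2(1,2) by (auto intro!: cC intro: subsetD[OF f2(3)])
    have span: "\<exists>c\<in>{..<n * m} \<rightarrow> A. w = (\<Oplus>k\<in>{..<n * m}. c k \<otimes> ?X k)" if w: "w \<in> C" for w
    proof -
      \<comment> \<open>The coefficient of \<open>x i\<close> in \<open>w\<close> is
        \<open>s (w \<otimes> y i)\<close>, an element of \<open>B\<close>; its own coefficient at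
        \<open>u j\<close> is \<open>e i j\<close>.\<close>
      define e where "e i j = t (s (w \<otimes> y i) \<otimes> v j)" for i j
      have sB: "s (w \<otimes> y i) \<in> B" if "i < n" for i
        using w that d2(2) cC f2(5) by auto
      have eA: "e i j \<in> A" if "i < n" "j < m" for i j
        unfolding e_def using sB that d1(2) cB f1(5) by auto
      have R: "e i j \<in> carrier R" "x i \<in> carrier R" "u j \<in> carrier R" if "i < n" "j < m" for i j
        using eA[OF that] d1(1) d2(1) that f1(3,4) f2(4) by auto
      have "w = (\<Oplus>i\<in>{..<n}. s (w \<otimes> y i) \<otimes> x i)"
        by (rule dual_bases_expand(1)[OF F2 D(2) w])
      also have "\<dots> = (\<Oplus>i\<in>{..<n}. \<Oplus>j\<in>{..<m}. e i j \<otimes> (x i \<otimes> u j))"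
      proof (intro finsum_cong')
        fix i assume "i \<in> {..<n}"
        then have i: "i < n" by simp
        have xi: "x i \<in> carrier R" using d2(1)[OF i] f2(4) by auto
        have "s (w \<otimes> y i) \<otimes> x i = (\<Oplus>j\<in>{..<m}. e i j \<otimes> u j) \<otimes> x i"
          using dual_bases_expand(1)[OF F1 D(1) sB[OF i]] by (simp add: e_def)
        also have "\<dots> = (\<Oplus>j\<in>{..<m}. e i j \<otimes> u j \<otimes> x i)"
          using R i xi by (intro finsum_ldistr) auto
        also have "\<dots> = (\<Oplus>j\<in>{..<m}. e i j \<otimes> (x i \<otimes> u j))"
          using R i by (intro finsum_cong') (auto simp: m_ac)
        finally show "s (w \<otimes> y i) \<otimes> x i = (\<Oplus>j\<in>{..<m}. e i j \<otimes> (x i \<otimes> u j))" .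
      qed (use R in \<open>auto intro!: finsum_closed\<close>)
      also have "\<dots> = (\<Oplus>k\<in>{..<n * m}. e (k div m) (k mod m) \<otimes> ?X k)"
        using R by (intro finsum_div_mod[symmetric]) auto
      finally show ?thesis
        using eA dm by (intro bexI[of _ "\<lambda>k. e (k div m) (k mod m)"]) auto
    qed
    \<comment> \<open>A linear relation is multiplied by the dual element \<open>?Y l\<close> and
      the composite trace is applied. Computed termwise the result is \<open>c l\<close>; computed
      on the whole sum it is zero.\<close>
    have indep: "c l = \<zero>"
      if c: "c \<in> {..<n * m} \<rightarrow> A" and z: "(\<Oplus>k\<in>{..<n * m}. c k \<otimes> ?X k) = \<zero>" and l: "l < n * m" for c l
    proof -
      have cA: "c k \<in> A" "c k \<in> B" "c k \<in> C" "c k \<in> carrier R" if "k < n * m" for k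
        using c that f1(3,4) f2(3) by auto
      have XR: "?X k \<in> carrier R" "?Y k \<in> carrier R" if "k < n * m" for k
        using XC[OF that] f2(4) by auto
      have "(\<Oplus>k\<in>{..<n * m}. t (s (c k \<otimes> ?X k \<otimes> ?Y l))) = (\<Oplus>k\<in>{..<n * m}. if l = k then c k else \<zero>)"
      proof (intro finsum_cong')
        fix k assume "k \<in> {..<n * m}"
        then have k: "k < n * m" by simp
        have XY: "?X k \<otimes> ?Y l \<in> C" using XC(1)[OF k] XC(2)[OF l] cC by blast
        have "t (s (c k \<otimes> ?X k \<otimes> ?Y l)) = t (s (c k \<otimes> (?X k \<otimes> ?Y l)))"
          using XR cA k l by (simp only: m_assoc)
        also have "\<dots> = c k \<otimes> t (s (?X k \<otimes> ?Y l))"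
          using f2(7)[OF cA(2)[OF k] XY] f1(7)[OF cA(1)[OF k] f2(5)[OF XY]] by simp
        also have "\<dots> = c k \<otimes> (if k div m = l div m \<and> k mod m = l mod m then \<one> else \<zero>)"
          using pairing[OF D dm(1)[OF k] dm(1)[OF l] dm(2)[OF k] dm(2)[OF l]] by simp
        also have "k div m = l div m \<and> k mod m = l mod m \<longleftrightarrow> l = k"
          by (metis div_mult_mod_eq)
        finally show "t (s (c k \<otimes> ?X k \<otimes> ?Y l)) = (if l = k then c k else \<zero>)"
          using cA k by simp
      qed (use cA in auto)
      also have "\<dots> = c l"
        using cA l by (intro finsum_singleton) auto
      also have "(\<Oplus>k\<in>{..<n * m}. t (s (c k \<otimes> ?X k \<otimes> ?Y l))) =
          t (s (\<Oplus>k\<in>{..<n * m}. c k \<otimes> ?X k \<otimes> ?Y l))"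
      proof -
        have ZC: "c k \<otimes> ?X k \<otimes> ?Y l \<in> C" if "k \<in> {..<n * m}" for k
          using XC(1)[of k] XC(2)[OF l] cA(3)[of k] cC that by simp
        show ?thesis
          by (simp only: frobenius_extension_finsum[OF F2 finite_lessThan ZC]
              frobenius_extension_finsum[OF F1 finite_lessThan f2(5)[OF ZC]])
      qed
      also have "(\<Oplus>k\<in>{..<n * m}. c k \<otimes> ?X k \<otimes> ?Y l) = (\<Oplus>k\<in>{..<n * m}. c k \<otimes> ?X k) \<otimes> ?Y l"
        using XR cA l by (intro finsum_ldistr[symmetric]) auto
      also have "\<dots> = \<zero>"
        using XR(2)[OF l] z by simp
      finally show ?thesis
        by (simp add: frobenius_extension_zero[OF F1] frobenius_extension_zero[OF F2])
    qed
    show ?thesis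
      unfolding is_basis_def using XC(1) span indep by auto
  qed
  have "k div m = l div m \<and> k mod m = l mod m \<longleftrightarrow> k = l" for k l
    by (metis div_mult_mod_eq)
  then show ?thesis
    unfolding dual_bases_def
    using basis[OF D1 D2] basis[OF dual_bases_sym[OF D1 f1(4)] dual_bases_sym[OF D2 f2(4)]]
      pairing[OF D1 D2] dm by simp
qed

lemma frobenius_extension_tower:
  assumes "frobenius_extension R A B t" "frobenius_extension R B C s"
  shows "frobenius_extension R A C (t \<circ> s)"
proof -
  obtain m u v n x y where "dual_bases R A B t m u v" "dual_bases R B C s n x y"
    using assms unfolding frobenius_extension_def by blast
  then have "\<exists>n x y. dual_bases R A C (t \<circ> s) n x y"
    using dual_bases_tower[OF assms] by blast
  moreover have "is_linear R A C (t \<circ> s)"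
    using frobenius_extensionD[OF assms(1)] frobenius_extensionD[OF assms(2)]
    by (auto simp: is_linear_def subset_iff)
  ultimately show ?thesis
    using assms by (auto simp: frobenius_extension_def Pi_iff)
qed

text \<open>Traces are total functions, and two composites that represent the same trace may differ
  outside \<open>B\<close>. Duality evaluates the trace only at products of basis elements, which
  lie in \<open>B\<close>.\<close>

lemma dual_bases_trace_cong:
  assumes "frobenius_extension R A B tr" "\<And>u. u \<in> B \<Longrightarrow> tr u = tr' u"
  shows "dual_bases R A B tr n x y \<longleftrightarrow> dual_bases R A B tr' n x y"
proof -
  have "x i \<otimes> y j \<in> B" if "is_basis R A B n x" "is_basis R A B n y" "i < n" "j < n" for i j
    using that subringE(6)[OF frobenius_extensionD(2)[OF assms(1)]]
    by (auto simp: is_basis_def)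
  then show ?thesis
    unfolding dual_bases_def using assms(2) by (metis (no_types, lifting))
qed

text \<open>Product bases turn the Sweedler sum into a double sum. The trace \<open>tr\<close> only
  has to agree with \<open>t \<circ> s\<close> on \<open>C\<close>, so one and the same expression
  can be evaluated through different intermediate rings.\<close>

lemma sweedler_tower:
  assumes F1: "frobenius_extension R A B t" and F2: "frobenius_extension R B C s"
    and D1: "dual_bases R A B t m u v" and D2: "dual_bases R B C s n x y"
    and F: "frobenius_extension R A C tr" and tr: "\<And>w. w \<in> C \<Longrightarrow> t (s w) = tr w"
    and fc: "\<And>u v. u \<in> C \<Longrightarrow> v \<in> C \<Longrightarrow> f u v \<in> carrier R"
    and fl: "\<And>u u' v. u \<in> C \<Longrightarrow> u' \<in> C \<Longrightarrow> v \<in> C \<Longrightarrow> f (u \<oplus> u') v = f u v \<oplus> f u' v"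
    and fr: "\<And>u v v'. u \<in> C \<Longrightarrow> v \<in> C \<Longrightarrow> v' \<in> C \<Longrightarrow> f u (v \<oplus> v') = f u v \<oplus> f u v'"
    and fb: "\<And>a u v. a \<in> A \<Longrightarrow> u \<in> C \<Longrightarrow> v \<in> C \<Longrightarrow> f (a \<otimes> u) v = f u (a \<otimes> v)"
  shows "sweedler R A C tr f = (\<Oplus>i\<in>{..<n}. \<Oplus>j\<in>{..<m}. f (x i \<otimes> u j) (y i \<otimes> v j))"
proof -
  have D: "dual_bases R A C tr (n * m)
      (\<lambda>k. x (k div m) \<otimes> u (k mod m)) (\<lambda>k. y (k div m) \<otimes> v (k mod m))"
    using dual_bases_tower[OF F1 F2 D1 D2]
      dual_bases_trace_cong[OF frobenius_extension_tower[OF F1 F2], of tr] tr by simp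
  note f2 = frobenius_extensionD[OF F2]
  have C: "x i \<otimes> u j \<in> C" "y i \<otimes> v j \<in> C" if "i < n" "j < m" for i j
    using dual_basesD(1,2)[OF D1] dual_basesD(1,2)[OF D2] that
    by (auto intro!: subringE(6)[OF f2(2)] intro: subsetD[OF f2(3)])
  show ?thesis
    using sweedler_eq[OF F D fc fl fr fb]
      finsum_div_mod[of n m "\<lambda>i j. f (x i \<otimes> u j) (y i \<otimes> v j)"] fc C by simp
qed

section \<open>The elements \<mu> and their multiplicativity in towers\<close>

text \<open>Multiplication is biadditive and balanced over \<open>A\<close>, so any dual bases may
  be used to compute \<mu>.\<close>

lemma frob_mu_eq:
  assumes "frobenius_extension R A B tr" "dual_bases R A B tr n x y"
  shows "frob_mu R A B tr = (\<Oplus>i\<in>{..<n}. x i \<otimes> y i)"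
proof -
  note F = frobenius_extensionD[OF assms(1)]
  have "u \<in> carrier R" if "u \<in> B" for u using F(4) that by auto
  moreover have "a \<in> carrier R" if "a \<in> A" for a using F(3,4) that by auto
  ultimately show ?thesis
    unfolding frob_mu_def by (intro sweedler_eq[OF assms]) (auto simp: l_distr r_distr m_ac)
qed

lemma frob_mu_closed:
  assumes "frobenius_extension R A B tr"
  shows "frob_mu R A B tr \<in> carrier R"
proof -
  obtain n x y where D: "dual_bases R A B tr n x y"
    using assms by (auto simp: frobenius_extension_def)
  then show ?thesis
    using frob_mu_eq[OF assms D] dual_basesD(1,2)[OF D] frobenius_extensionD(4)[OF assms]
    by (auto intro!: finsum_closed)
qed

text \<open>In product bases the terms regroup as
  \<open>(x i \<otimes> y i) \<otimes> (u j \<otimes> v j)\<close>, and the double sum splits into a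
  product of two sums.\<close>

lemma frob_mu_tower:
  assumes F1: "frobenius_extension R A B t" and F2: "frobenius_extension R B C s"
  shows "frob_mu R A C (t \<circ> s) = frob_mu R B C s \<otimes> frob_mu R A B t"
proof -
  obtain m u v n x y where D1: "dual_bases R A B t m u v" and D2: "dual_bases R B C s n x y"
    using assms unfolding frobenius_extension_def by blast
  note f1 = frobenius_extensionD[OF F1] and f2 = frobenius_extensionD[OF F2]
  have CR: "w \<in> carrier R" if "w \<in> C" for w using f2(4) that by auto
  have AR: "a \<in> carrier R" if "a \<in> A" for a using f1(3,4) that by auto
  have R: "x i \<in> carrier R" "y i \<in> carrier R" "u j \<in> carrier R" "v j \<in> carrier R"
    if "i < n" "j < m" for i j
    using dual_basesD(1,2)[OF D1] dual_basesD(1,2)[OF D2] that f1(4) f2(4) by auto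
  have R': "x i \<otimes> y i \<in> carrier R" if "i < n" for i
    using dual_basesD(1,2)[OF D2] that f2(4) by auto
  have R'': "u j \<otimes> v j \<in> carrier R" if "j < m" for j
    using dual_basesD(1,2)[OF D1] that f1(4) by auto
  have "frob_mu R A C (t \<circ> s) = (\<Oplus>i\<in>{..<n}. \<Oplus>j\<in>{..<m}. (x i \<otimes> u j) \<otimes> (y i \<otimes> v j))"
    unfolding frob_mu_def
    by (rule sweedler_tower[OF F1 F2 D1 D2 frobenius_extension_tower[OF F1 F2]])
      (auto simp: CR AR l_distr r_distr m_ac)
  also have "\<dots> = (\<Oplus>i\<in>{..<n}. \<Oplus>j\<in>{..<m}. (x i \<otimes> y i) \<otimes> (u j \<otimes> v j))"
    using R by (intro finsum_cong') (auto simp: m_ac intro!: finsum_cong' finsum_closed)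
  also have "\<dots> = (\<Oplus>i\<in>{..<n}. x i \<otimes> y i) \<otimes> (\<Oplus>j\<in>{..<m}. u j \<otimes> v j)"
    using R' R'' by (intro finsum_mult_finsum) auto
  finally show ?thesis
    by (simp add: frob_mu_eq[OF F1 D1] frob_mu_eq[OF F2 D2])
qed

section \<open>Evaluation of one Sweedler expression through both intermediate rings\<close>

text \<open>This is the formula with the denominators cleared and before multiplication by the \<mu>
  of \<open>R\<close> over \<open>Rr\<close>. Both sides equal the Sweedler expression of
  \<open>R\<close> over \<open>Rrb\<close> for \<open>tr_r u \<otimes> v\<close>, the left one
  through \<open>Rb\<close> and the right one through \<open>Rr\<close>.\<close>

lemma sweedler_trace_eq:
  assumes Fr: "frobenius_extension R Rr (carrier R) tr_r"
    and Frrb: "frobenius_extension R Rrb Rr tr_r_rb"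
    and Fb: "frobenius_extension R Rb (carrier R) tr_b"
    and Fbrb: "frobenius_extension R Rrb Rb tr_b_rb"
    and compat: "\<And>u. u \<in> carrier R \<Longrightarrow> tr_r_rb (tr_r u) = tr_b_rb (tr_b u)"
    and star: "condition_star R Rr Rb tr_b"
  defines "lhs \<equiv> sweedler R Rrb Rb tr_b_rb (\<lambda>u v. tr_r u \<otimes> v)"
  shows "lhs \<in> carrier R" "frob_mu R Rb (carrier R) tr_b \<otimes> lhs = frob_mu R Rrb Rr tr_r_rb"
proof -
  let ?f = "\<lambda>u v. tr_r u \<otimes> v"
  note fr = frobenius_extensionD[OF Fr] and frrb = frobenius_extensionD[OF Frrb]
  note fbrb = frobenius_extensionD[OF Fbrb]
  have trR: "tr_r w \<in> carrier R" if "w \<in> carrier R" for w using fr(3,5) that by auto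
  have rbR: "a \<in> Rr" "a \<in> carrier R" if "a \<in> Rrb" for a using frrb(3,4) that by auto
  have bR: "a \<in> carrier R" if "a \<in> Rb" for a using fbrb(4) that by auto
  \<comment> \<open>Scalars from \<open>Rrb\<close> lie in \<open>Rr\<close>, over which
    \<open>tr_r\<close> is linear. This makes the expression balanced over \<open>Rrb\<close>, hence
    independent of the dual bases.\<close>
  have tr_rb: "tr_r (a \<otimes> w) = a \<otimes> tr_r w" if "a \<in> Rrb" "w \<in> carrier R" for a w
    using fr(7) rbR(1) that by blast
  have F: "frobenius_extension R Rrb (carrier R) (tr_r_rb \<circ> tr_r)"
    by (rule frobenius_extension_tower[OF Frrb Fr])
  have closed: "tr_r u \<otimes> v \<in> carrier R" if "u \<in> carrier R" "v \<in> carrier R" for u v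
    using that trR by simp
  have add_left: "tr_r (u \<oplus> u') \<otimes> v = tr_r u \<otimes> v \<oplus> tr_r u' \<otimes> v"
    if "u \<in> carrier R" "u' \<in> carrier R" "v \<in> carrier R" for u u' v
    using that trR by (simp add: fr(6) l_distr)
  have add_right: "tr_r u \<otimes> (v \<oplus> v') = tr_r u \<otimes> v \<oplus> tr_r u \<otimes> v'"
    if "u \<in> carrier R" "v \<in> carrier R" "v' \<in> carrier R" for u v v'
    using that trR by (simp add: r_distr)
  have balanced: "tr_r (a \<otimes> u) \<otimes> v = tr_r u \<otimes> (a \<otimes> v)"
    if "a \<in> Rrb" "u \<in> carrier R" "v \<in> carrier R" for a u v
    using that trR rbR by (simp add: tr_rb m_ac)
  obtain n x y where Db: "dual_bases R Rb (carrier R) tr_b n x y" and xr: "\<And>i. i < n \<Longrightarrow> x i \<in> Rr"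
    using star unfolding condition_star_def by blast
  obtain m u v where Dbrb: "dual_bases R Rrb Rb tr_b_rb m u v"
    using Fbrb unfolding frobenius_extension_def by blast
  obtain k p q where Dr: "dual_bases R Rr (carrier R) tr_r k p q"
    using Fr unfolding frobenius_extension_def by blast
  obtain l e g where Drrb: "dual_bases R Rrb Rr tr_r_rb l e g"
    using Frrb unfolding frobenius_extension_def by blast
  have uR: "u j \<in> carrier R" "v j \<in> carrier R" if "j < m" for j
    using dual_basesD(1,2)[OF Dbrb] that bR by auto
  have xR: "x i \<in> carrier R" "y i \<in> carrier R" if "i < n" for i
    using dual_basesD(1,2)[OF Db] that by auto
  have eR: "e j \<in> Rr" "e j \<in> carrier R" "g j \<in> carrier R" if "j < l" for j
    using dual_basesD(1,2)[OF Drrb] that frrb(4) by auto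
  have pR: "p i \<in> carrier R" "q i \<in> carrier R" if "i < k" for i
    using dual_basesD(1,2)[OF Dr] that by auto
  have lhs: "lhs = (\<Oplus>j\<in>{..<m}. tr_r (u j) \<otimes> v j)"
    unfolding lhs_def by (rule sweedler_eq[OF Fbrb Dbrb]) (simp_all only: bR closed add_left add_right balanced)
  then show "lhs \<in> carrier R"
    using uR trR by (auto intro!: finsum_closed)
  have "frob_mu R Rb (carrier R) tr_b \<otimes> lhs =
      (\<Oplus>i\<in>{..<n}. \<Oplus>j\<in>{..<m}. (x i \<otimes> y i) \<otimes> (tr_r (u j) \<otimes> v j))"
    unfolding lhs frob_mu_eq[OF Fb Db]
    using uR xR trR by (intro finsum_mult_finsum[symmetric]) auto
  \<comment> \<open>Condition \<star> enters here: since \<open>x i\<close> lies in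
    \<open>Rr\<close>, it can be moved inside \<open>tr_r\<close>.\<close>
  also have "\<dots> = (\<Oplus>i\<in>{..<n}. \<Oplus>j\<in>{..<m}. tr_r (x i \<otimes> u j) \<otimes> (y i \<otimes> v j))"
  proof -
    have "(x i \<otimes> y i) \<otimes> (tr_r (u j) \<otimes> v j) = tr_r (x i \<otimes> u j) \<otimes> (y i \<otimes> v j)"
      if "i < n" "j < m" for i j
      using fr(7)[OF xr[OF that(1)] uR(1)[OF that(2)]] xR[OF that(1)] uR[OF that(2)] trR
      by (simp add: m_ac)
    then show ?thesis
      using uR xR trR by (intro finsum_cong') (auto intro!: finsum_cong' finsum_closed)
  qed
  \<comment> \<open>The tower through \<open>Rb\<close> has composite trace
    \<open>tr_b_rb \<circ> tr_b\<close>; compatibility identifies it on \<open>R\<close> with the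
    composite through \<open>Rr\<close>.\<close>
  also have "\<dots> = sweedler R Rrb (carrier R) (tr_r_rb \<circ> tr_r) ?f"
    by (rule sweedler_tower[OF Fbrb Fb Dbrb Db F, symmetric])
      (simp_all only: o_apply compat closed add_left add_right balanced)
  also have "\<dots> = (\<Oplus>i\<in>{..<k}. \<Oplus>j\<in>{..<l}. tr_r (p i \<otimes> e j) \<otimes> (q i \<otimes> g j))"
    by (rule sweedler_tower[OF Frrb Fr Drrb Dr F])
      (simp_all only: o_apply closed add_left add_right balanced)
  \<comment> \<open>In the tower through \<open>Rr\<close> the basis elements \<open>e j\<close> lie
    in \<open>Rr\<close> by construction and come out of \<open>tr_r\<close>.\<close>
  also have "\<dots> = (\<Oplus>i\<in>{..<k}. \<Oplus>j\<in>{..<l}. (tr_r (p i) \<otimes> q i) \<otimes> (e j \<otimes> g j))"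
  proof -
    have "tr_r (p i \<otimes> e j) \<otimes> (q i \<otimes> g j) = (tr_r (p i) \<otimes> q i) \<otimes> (e j \<otimes> g j)"
      if "i < k" "j < l" for i j
      using fr(7)[OF eR(1)[OF that(2)] pR(1)[OF that(1)]] pR[OF that(1)] eR[OF that(2)] trR
      by (simp add: m_ac)
    then show ?thesis
      using pR eR trR by (intro finsum_cong') (auto intro!: finsum_cong' finsum_closed)
  qed
  also have "\<dots> = (\<Oplus>i\<in>{..<k}. tr_r (p i) \<otimes> q i) \<otimes> (\<Oplus>j\<in>{..<l}. e j \<otimes> g j)"
    using pR eR trR by (intro finsum_mult_finsum) auto
  \<comment> \<open>The factor \<open>\<one>\<close> is inserted to expose the expansion of
    \<open>\<one>\<close> in the basis \<open>q\<close>.\<close>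
  also have "(\<Oplus>i\<in>{..<k}. tr_r (p i) \<otimes> q i) = (\<Oplus>i\<in>{..<k}. tr_r (p i \<otimes> \<one>) \<otimes> q i)"
    using pR trR by (intro finsum_cong') auto
  also have "\<dots> = \<one>"
    using dual_bases_expand(2)[OF Fr Dr one_closed] by simp
  also have "\<one> \<otimes> (\<Oplus>j\<in>{..<l}. e j \<otimes> g j) = frob_mu R Rrb Rr tr_r_rb"
    using eR by (simp add: frob_mu_eq[OF Frrb Drrb] finsum_closed Pi_iff)
  finally show "frob_mu R Rb (carrier R) tr_b \<otimes> lhs = frob_mu R Rrb Rr tr_r_rb" .
qed

section \<open>Injectivity and units for the localization\<close>

text \<open>Equality of fractions holds only up to a power of \<open>s\<close>; this cancels that
  power, one factor at a time.\<close>

lemma non_zero_divisor_pow: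
  assumes "non_zero_divisor R s" "u \<in> carrier R" "s [^] (k::nat) \<otimes> u = \<zero>"
  shows "u = \<zero>"
  using assms(3)
proof (induction k)
  case 0
  then show ?case using assms by simp
next
  case (Suc k)
  have s: "s \<in> carrier R" using assms(1) by (simp add: non_zero_divisor_def)
  have "s \<otimes> (s [^] k \<otimes> u) = \<zero>"
    using Suc.prems s assms(2) by (simp add: m_ac)
  moreover have "s [^] k \<otimes> u \<in> carrier R"
    using s assms(2) by simp
  ultimately have "s [^] k \<otimes> u = \<zero>"
    using assms(1) unfolding non_zero_divisor_def by blast
  then show ?case by (rule Suc.IH)
qed

lemma inj_loc_of:
  assumes "non_zero_divisor R s"
  shows "inj_on (loc_of R s) (carrier R)"
proof (rule inj_onI)
  fix a b assume ab: "a \<in> carrier R" "b \<in> carrier R" and eq: "loc_of R s a = loc_of R s b"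
  have s: "s \<in> carrier R" using assms by (simp add: non_zero_divisor_def)
  obtain k :: nat where "s [^] k \<otimes> a = s [^] k \<otimes> b"
    using eq ab by (auto simp: loc_of_def loc_frac_eq_iff[OF s])
  then have "s [^] k \<otimes> (a \<ominus> b) = \<zero>"
    using s ab by (simp add: minus_eq r_distr r_minus r_neg)
  then show "a = b"
    using non_zero_divisor_pow[OF assms, of "a \<ominus> b" k] ab by simp
qed

text \<open>Every divisor of \<open>s\<close> becomes invertible: the inverse of \<open>a\<close> is
  the fraction \<open>b / s\<close>, because \<open>a \<otimes> b = s\<close>.\<close>

lemma loc_of_Units:
  assumes "a \<in> carrier R" "b \<in> carrier R" "a \<otimes> b = s"
  shows "loc_of R s a \<in> Units (localization R s)"
proof -
  have s: "s \<in> carrier R" using assms by auto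
  interpret L: cring "localization R s" by (rule localization_cring[OF s])
  have "loc_of R s a \<otimes>\<^bsub>localization R s\<^esub> loc_frac R s b 1 = \<one>\<^bsub>localization R s\<^esub>"
    using assms s by (simp add: loc_of_def loc_mult loc_one loc_frac_eqI)
  then show ?thesis
    using assms by (metis L.Units_one_closed L.unit_factor loc_frac_closed loc_of_def)
qed

end

section \<open>The formula in the localization at \<mu>rb\<close>

text \<open>Injectivity of \<iota> expresses that the localization contains \<open>R\<close>, and
  the two unit statements give the fraction its meaning. The identity itself already holds in
  \<open>R\<close> with denominators cleared, so what remains is to map it along \<iota> and
  divide.\<close>

theorem claim2p3:
  fixes K :: "('k, 'l) ring_scheme" and R :: "('k, 'a, 'm) module_scheme"
    and Rr Rb Rrb :: "'a set" and tr_r tr_b tr_r_rb tr_b_rb :: "'a \<Rightarrow> 'a"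
  assumes "compatible_frobenius_square K R Rr Rb Rrb tr_r tr_b tr_r_rb tr_b_rb"
    and "condition_star R Rr Rb tr_b"
    and "non_zero_divisor R (frob_mu R Rrb (carrier R) (tr_r_rb \<circ> tr_r))"
  shows
    "let \<mu>r = frob_mu R Rr (carrier R) tr_r;
         \<mu>b = frob_mu R Rb (carrier R) tr_b;
         \<mu>rb = frob_mu R Rrb (carrier R) (tr_r_rb \<circ> tr_r);
         lhs = sweedler R Rrb Rb tr_b_rb (\<lambda>u v. tr_r u \<otimes>\<^bsub>R\<^esub> v);
         L = localization R \<mu>rb;
         \<iota> = loc_of R \<mu>rb
     in inj_on \<iota> (carrier R) \<and>
        \<mu>r \<in> carrier R \<and> \<mu>b \<in> carrier R \<and> lhs \<in> carrier R \<and>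
        \<iota> \<mu>r \<in> Units L \<and> \<iota> \<mu>b \<in> Units L \<and>
        \<iota> lhs = \<iota> \<mu>rb \<otimes>\<^bsub>L\<^esub> inv\<^bsub>L\<^esub> (\<iota> \<mu>r \<otimes>\<^bsub>L\<^esub> \<iota> \<mu>b)"
proof -
  have sq: "algebra K R" "frobenius_extension R Rr (carrier R) tr_r"
      "frobenius_extension R Rb (carrier R) tr_b" "frobenius_extension R Rrb Rr tr_r_rb"
      "frobenius_extension R Rrb Rb tr_b_rb"
    and compat: "\<And>u. u \<in> carrier R \<Longrightarrow> tr_r_rb (tr_r u) = tr_b_rb (tr_b u)"
    using assms(1) by (auto simp: compatible_frobenius_square_def)
  interpret R: cring R using sq(1) by (simp add: algebra_def)
  define \<mu>r \<mu>b \<mu>rb \<mu>r_rb lhs where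
    "\<mu>r = frob_mu R Rr (carrier R) tr_r" and
    "\<mu>b = frob_mu R Rb (carrier R) tr_b" and
    "\<mu>rb = frob_mu R Rrb (carrier R) (tr_r_rb \<circ> tr_r)" and
    "\<mu>r_rb = frob_mu R Rrb Rr tr_r_rb" and
    "lhs = sweedler R Rrb Rb tr_b_rb (\<lambda>u v. tr_r u \<otimes>\<^bsub>R\<^esub> v)"
  note defs = this
  have c: "\<mu>r \<in> carrier R" "\<mu>b \<in> carrier R" "lhs \<in> carrier R"
    using R.frob_mu_closed sq R.sweedler_trace_eq(1)[OF sq(2,4,3,5) compat assms(2)]
    by (auto simp: defs)
  have key: "\<mu>b \<otimes>\<^bsub>R\<^esub> lhs = \<mu>r_rb"
    using R.sweedler_trace_eq(2)[OF sq(2,4,3,5) compat assms(2)] by (simp add: defs)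
  have "\<mu>rb = \<mu>r \<otimes>\<^bsub>R\<^esub> \<mu>r_rb"
    using R.frob_mu_tower[OF sq(4,2)] by (simp add: defs)
  then have prod: "\<mu>r \<otimes>\<^bsub>R\<^esub> (\<mu>b \<otimes>\<^bsub>R\<^esub> lhs) = \<mu>rb" using key by simp
  \<comment> \<open>Three groupings of one product: the first two exhibit \<mu>r and \<mu>b as
    divisors of \<mu>rb, which makes them units after localization; the last is the formula before
    division.\<close>
  then have prod': "\<mu>b \<otimes>\<^bsub>R\<^esub> (\<mu>r \<otimes>\<^bsub>R\<^esub> lhs) = \<mu>rb" "lhs \<otimes>\<^bsub>R\<^esub> (\<mu>r \<otimes>\<^bsub>R\<^esub> \<mu>b) = \<mu>rb"
    using c by (simp_all add: R.m_ac)
  have s: "\<mu>rb \<in> carrier R" using prod c by auto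
  let ?L = "localization R \<mu>rb" and ?i = "loc_of R \<mu>rb"
  interpret L: cring ?L by (rule R.localization_cring[OF s])
  note hom = R.loc_of_hom[OF s]
  note hm = ring_hom_mult[OF hom] and hc = ring_hom_closed[OF hom]
  have U: "?i \<mu>r \<in> Units ?L" "?i \<mu>b \<in> Units ?L"
    using R.loc_of_Units[OF _ _ prod] R.loc_of_Units[OF _ _ prod'(1)] c by auto
  then have U': "?i \<mu>r \<otimes>\<^bsub>?L\<^esub> ?i \<mu>b \<in> Units ?L" by simp
  have "?i \<mu>rb = ?i lhs \<otimes>\<^bsub>?L\<^esub> (?i \<mu>r \<otimes>\<^bsub>?L\<^esub> ?i \<mu>b)"
    using c hm[of lhs "\<mu>r \<otimes>\<^bsub>R\<^esub> \<mu>b"] by (simp add: hm prod'(2))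
  then have "?i \<mu>rb \<otimes>\<^bsub>?L\<^esub> inv\<^bsub>?L\<^esub> (?i \<mu>r \<otimes>\<^bsub>?L\<^esub> ?i \<mu>b) = ?i lhs"
    using L.Units_r_inv[OF U'] L.Units_closed[OF U'] L.Units_inv_closed[OF U'] hc[OF c(3)]
    by (simp add: L.m_assoc)
  then show ?thesis
    using R.inj_loc_of[of \<mu>rb] assms(3) c U by (simp add: Let_def flip: defs)
qed

end
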